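(* Let $a>1/2$ and assume $B(s_0(a))^2>2K(a)^2$. The following are equivalent: (i) $\phi_a(s)>0$ for every $s\in[0,s_0(a)]$; (ii) $\phi_a(s_0(a))>0$; (iii) $K(a)^2\,r'(a)\,\coth r(a)>a$, namely $(a^2-1/4)\,r'(a)>a\tanh r(a)$; (iv) $\dfrac{d}{da}\left[\dfrac{\sinh r(a)}{K(a)}\right]>0$; (v) $y'(a)>0$, where $y(a):=B(s_0(a))^2/K(a)^2$.
   Context: Let $\langle x,y\rangle_L=-x_0y_0+x_1y_1+x_2y_2+x_3y_3$ on $\mathbb{R}^4$. For $a>1/2$ put $A(s)=\sqrt{a\cosh(2s)+\tfrac12}$, $B(s)=\sqrt{a\cosh(2s)-\tfrac12}$, $K=K(a)=\sqrt{a^2-\tfrac14}$, and $\varphi(s)=\int_0^s\frac{K}{A(t)^2B(t)}\,dt$. Let $s_0=s_0(a)>0$ be the unique positive solution of $\tanh\varphi(s_0)=\frac{B(s_0)K}{a\sinh(2s_0)}$, and let $r(a)>0$ be defined by $\cosh r(a)=A(s_0)\cosh\varphi(s_0)$; $r$ and $s_0$ are real-analytic in $a$, and primes on $r$ and $y$ denote $d/da$ (with $B(s_0(a))$ evaluated for the parameter $a$). The critical spherical catenoid $\Sigma_a$ is parametrized, for $|s|\le s_0$, by $X_a(s,\theta)=(A\cosh\varphi,A\sinh\varphi,B\cos\theta,B\sin\theta)$ in the hyperboloid model of $\mathbb{H}^3$. The parametric Jacobi field is $\phi_a:=\langle\partial_aX_a,\nu_a\rangle_L$, where $\partial_a$ is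 taken at fixed $(s,\theta)$ and $\nu_a=\bigl(\tfrac{K\cosh\varphi}{A}-\tfrac{a\sinh(2s)\sinh\varphi}{AB},\ \tfrac{K\sinh\varphi}{A}-\tfrac{a\sinh(2s)\cosh\varphi}{AB},\ \tfrac{K}{B}\cos\theta,\ \tfrac{K}{B}\sin\theta\bigr)$ is the unit normal; $\phi_a$ depends only on $s$. *)

theory Defs
  imports "HOL-Analysis.Analysis"
begin

(* Coordinates x_0, ..., x_3 on R^4 are x $ 0, ..., x $ 3.  In the index type 4 the numeral 0
   denotes the same index as 4, and 0, 1, 2, 3 are pairwise distinct. *)
definition vec4 :: "real \<Rightarrow> real \<Rightarrow> real \<Rightarrow> real \<Rightarrow> real ^ 4" where
  "vec4 x0 x1 x2 x3 = (\<chi> i. if i = 0 then x0 else if i = 1 then x1 else if i = 2 then x2 else x3)"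

lemma vec4_nth [simp]:
  "vec4 x0 x1 x2 x3 $ 0 = x0"
  "vec4 x0 x1 x2 x3 $ 1 = x1"
  "vec4 x0 x1 x2 x3 $ 2 = x2"
  "vec4 x0 x1 x2 x3 $ 3 = x3"
  by (simp_all add: vec4_def)

definition lorentz :: "real ^ 4 \<Rightarrow> real ^ 4 \<Rightarrow> real" where
  "lorentz x y = - (x $ 0 * y $ 0) + x $ 1 * y $ 1 + x $ 2 * y $ 2 + x $ 3 * y $ 3"

definition coth :: "real \<Rightarrow> real" where
  "coth x = cosh x / sinh x"

definition cat_A :: "real \<Rightarrow> real \<Rightarrow> real" where
  "cat_A a s = sqrt (a * cosh (2 * s) + 1 / 2)"

definition cat_B :: "real \<Rightarrow> real \<Rightarrow> real" where
  "cat_B a s = sqrt (a * cosh (2 * s) - 1 / 2)"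

definition cat_K :: "real \<Rightarrow> real" where
  "cat_K a = sqrt (a\<^sup>2 - 1 / 4)"

(* The integral is oriented, so this is the intended value for negative s as well. *)
definition cat_phi :: "real \<Rightarrow> real \<Rightarrow> real" where
  "cat_phi a s = (LBINT t=ereal 0..ereal s. cat_K a / ((cat_A a t)\<^sup>2 * cat_B a t))"

definition cat_s0 :: "real \<Rightarrow> real" where
  "cat_s0 a = (THE s. s > 0 \<and> tanh (cat_phi a s) = cat_B a s * cat_K a / (a * sinh (2 * s)))"

definition cat_r :: "real \<Rightarrow> real" where
  "cat_r a = (THE \<rho>. \<rho> > 0 \<and> cosh \<rho> = cat_A a (cat_s0 a) * cosh (cat_phi a (cat_s0 a)))"

(* The catenoid is the part |s| \<le> cat_s0 a.  The formula is kept for all s, so that the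
   parameter derivative below makes sense at the boundary s = cat_s0 a, which moves with a. *)
definition cat_X :: "real \<Rightarrow> real \<Rightarrow> real \<Rightarrow> real ^ 4" where
  "cat_X a s \<theta> = vec4
     (cat_A a s * cosh (cat_phi a s))
     (cat_A a s * sinh (cat_phi a s))
     (cat_B a s * cos \<theta>)
     (cat_B a s * sin \<theta>)"

definition cat_nu :: "real \<Rightarrow> real \<Rightarrow> real \<Rightarrow> real ^ 4" where
  "cat_nu a s \<theta> = vec4
     (cat_K a * cosh (cat_phi a s) / cat_A a s
        - a * sinh (2 * s) * sinh (cat_phi a s) / (cat_A a s * cat_B a s))
     (cat_K a * sinh (cat_phi a s) / cat_A a s
        - a * sinh (2 * s) * cosh (cat_phi a s) / (cat_A a s * cat_B a s))
     (cat_K a / cat_B a s * cos \<theta>)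
     (cat_K a / cat_B a s * sin \<theta>)"

definition cat_jacobi :: "real \<Rightarrow> real \<Rightarrow> real \<Rightarrow> real" where
  "cat_jacobi a s \<theta> = lorentz (vector_derivative (\<lambda>b. cat_X b s \<theta>) (at a)) (cat_nu a s \<theta>)"

definition cat_y :: "real \<Rightarrow> real" where
  "cat_y a = (cat_B a (cat_s0 a))\<^sup>2 / (cat_K a)\<^sup>2"

end

theory Submission
  imports Defs
begin

text \<open>
  Throughout, \<open>A\<close>, \<open>B\<close>, \<open>K\<close> are as in the definitions, \<open>C = cosh (2 s)\<close> and \<open>S = a sinh (2 s)\<close>.
  Four relations carry every computation: \<open>A\<^sup>2 = B\<^sup>2 + 1\<close>, \<open>a C = B\<^sup>2 + 1/2\<close>,
  \<open>S\<^sup>2 = A\<^sup>2 B\<^sup>2 - K\<^sup>2\<close> and \<open>a\<^sup>2 = K\<^sup>2 + 1/4\<close>.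

  Expanding the Lorentz product, the parametric Jacobi field is the function
  \<open>J(s) = K C / (2 A\<^sup>2 B\<^sup>2) - (S / B) \<partial>\<^sub>a\<phi>(s)\<close> of \<open>s\<close> alone.  A second Jacobi field is \<open>S / B\<close>,
  which comes from a translation of the hyperbolic space.  The Wronskian of two rotationally
  symmetric Jacobi fields is a constant divided by \<open>B\<close>, hence the quotient \<open>J B / S\<close> has
  derivative \<open>- a B / (K S\<^sup>2)\<close> and decreases for \<open>s > 0\<close>.  So \<open>J\<close> is positive on
  the whole of \<open>{0..s\<^sub>0}\<close> as soon as it is positive at \<open>s\<^sub>0\<close>; this is the equivalence of (i) and (ii).

  At the contact parameter, \<open>tanh \<phi> = K B / S\<close> eliminates \<open>\<phi>\<close> from \<open>cosh r = A cosh \<phi>\<close> and gives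
  \<open>sinh r = B\<^sup>2 / sqrt (B\<^sup>2 - K\<^sup>2)\<close>, that is \<open>sinh r / K = y / sqrt (y - 1)\<close>
  (lemma \<open>sinh_cat_r\<close>).  The derivative of the right-hand side with respect to \<open>y\<close> is
  positive exactly for \<open>y > 2\<close>, which is the hypothesis \<open>B\<^sup>2 > 2 K\<^sup>2\<close>; so (iv) and (v) are equivalent.  Condition (iii) is (iv) after
  the quotient rule is written out.

  It remains to link (ii) and (v).  Differentiating the contact condition
  \<open>\<phi> = artanh (K B / S)\<close> along \<open>s\<^sub>0(a)\<close> yields \<open>s\<^sub>0'\<close> in terms of \<open>\<partial>\<^sub>a\<phi>\<close>, and inserting this into
  the derivative of \<open>y = B\<^sup>2 / K\<^sup>2\<close> produces the exact identity
  \<open>y' = 2 (B\<^sup>2 - K\<^sup>2) / K\<^sup>3 \<cdot> J(s\<^sub>0)\<close> (lemma \<open>cat_y_has_derivative\<close>), whose factor is positive.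

  The analytic input consists of the Leibniz rule for the integral \<open>\<phi>\<close>, existence and uniqueness
  of \<open>s\<^sub>0\<close> by monotonicity, and its differentiability by an implicit function argument.
\<close>

section \<open>Zeros depending on a parameter\<close>

text \<open>
  The zero of a strictly increasing function is trapped between any two points where the function
  has opposite signs, and these strict signs persist for nearby parameters.
\<close>
lemma isCont_implicit_zero:
  fixes F :: "real \<Rightarrow> real \<Rightarrow> real" and g :: "real \<Rightarrow> real"
  assumes zero: "\<forall>\<^sub>F b in nhds a. L < g b \<and> F b (g b) = 0"
    and mono: "\<And>b. b \<in> U \<Longrightarrow> strict_mono_on {L<..} (F b)"
    and U: "open U" "a \<in> U"
    and cont: "\<And>s. s > L \<Longrightarrow> isCont (\<lambda>b. F b s) a"
  shows "isCont g a"
proof -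
  have za: "L < g a" "F a (g a) = 0"
    using eventually_nhds_x_imp_x[OF zero] by auto
  have evU: "\<forall>\<^sub>F b in at a. b \<in> U"
    using U by (simp add: eventually_at_in_open')
  have evz: "\<forall>\<^sub>F b in at a. L < g b \<and> F b (g b) = 0"
    using zero by (auto simp: eventually_at_filter elim: eventually_mono)
  have less: "F b x < 0 \<longleftrightarrow> x < g b" "0 < F b x \<longleftrightarrow> g b < x"
    if "b \<in> U" "L < g b" "F b (g b) = 0" "L < x" for b x
    using strict_mono_on_less[OF mono[OF that(1)], of x "g b"]
      strict_mono_on_less[OF mono[OF that(1)], of "g b" x] that by auto
  have "(g \<longlongrightarrow> g a) (at a)"
  proof (rule order_tendstoI)
    fix l assume l: "l < g a"
    define x where "x = max l ((L + g a) / 2)"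
    have x: "L < x" "x < g a" "l \<le> x" using l za by (auto simp: x_def less_max_iff_disj)
    have "F a x < 0" using less[of a x] U za x by auto
    then have "\<forall>\<^sub>F b in at a. F b x < 0"
      using cont[OF x(1)] by (auto simp: isCont_def intro: order_tendstoD)
    with evU evz show "\<forall>\<^sub>F b in at a. l < g b"
      by eventually_elim (use less x in force)
  next
    fix x assume x: "g a < x"
    then have "L < x" using za by auto
    have "F a x > 0" using less[of a x] U za x by auto
    then have "\<forall>\<^sub>F b in at a. F b x > 0"
      using cont[OF \<open>L < x\<close>] by (auto simp: isCont_def intro: order_tendstoD)
    with evU evz show "\<forall>\<^sub>F b in at a. g b < x"
      by eventually_elim (use less \<open>L < x\<close> in force)
  qed
  then show ?thesis by (simp add: isCont_def)
qed

text \<open>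
  A one-dimensional implicit function theorem in which continuity of the solution is assumed.  The
  advantage over the general theorem is that in the parameter \<open>b\<close> differentiability is needed only
  along the single line \<open>s = g a\<close>: the mean value theorem in \<open>s\<close> turns \<open>F b (g b) = 0\<close> into
  \<open>(g b - g a) Fs b \<xi> = - F b (g a)\<close>, and \<open>\<xi>\<close> tends to \<open>g a\<close>.
\<close>
lemma implicit_zero_has_real_derivative:
  fixes F Fs :: "real \<Rightarrow> real \<Rightarrow> real" and g :: "real \<Rightarrow> real"
  assumes zero: "\<forall>\<^sub>F b in nhds a. F b (g b) = 0"
    and g: "isCont g a"
    and Fa: "((\<lambda>b. F b (g a)) has_real_derivative Fa) (at a)"
    and W: "open W" "(a, g a) \<in> W"
    and Fs: "\<And>b s. (b, s) \<in> W \<Longrightarrow> (F b has_real_derivative Fs b s) (at s)"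
    and cont: "isCont (\<lambda>(b, s). Fs b s) (a, g a)"
    and nz: "Fs a (g a) \<noteq> 0"
  shows "(g has_real_derivative - Fa / Fs a (g a)) (at a)"
proof -
  obtain d where d: "d > 0" "ball a d \<times> ball (g a) d \<subseteq> W"
  proof -
    from open_prod_elim[OF W] obtain A B where "open A" "open B" "(a, g a) \<in> A \<times> B" "A \<times> B \<subseteq> W"
      by blast
    moreover then obtain d1 d2 where "d1 > 0" "ball a d1 \<subseteq> A" "d2 > 0" "ball (g a) d2 \<subseteq> B"
      by (metis mem_Sigma_iff openE)
    ultimately show ?thesis
      by (intro that[of "min d1 d2"]) (auto simp: subset_iff)
  qed
  have near: "\<forall>\<^sub>F b in at a. b \<in> ball a d \<and> g b \<in> ball (g a) d"
  proof (rule eventually_conj)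
    show "\<forall>\<^sub>F b in at a. b \<in> ball a d"
      using d by (intro eventually_at_in_open') auto
    show "\<forall>\<^sub>F b in at a. g b \<in> ball (g a) d"
      using g d unfolding isCont_def by (metis centre_in_ball open_ball topological_tendstoD)
  qed
  have "\<forall>b. b \<in> ball a d \<and> g b \<in> ball (g a) d \<longrightarrow>
      (\<exists>x. \<bar>x - g a\<bar> \<le> \<bar>g b - g a\<bar> \<and> F b (g b) - F b (g a) = (g b - g a) * Fs b x)"
  proof (intro allI impI)
    fix b assume b: "b \<in> ball a d \<and> g b \<in> ball (g a) d"
    have der: "(F b has_real_derivative Fs b x) (at x)" if "\<bar>x - g a\<bar> \<le> \<bar>g b - g a\<bar>" for x
    proof (rule Fs)
      have "x \<in> ball (g a) d" using that b by (auto simp: dist_real_def)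
      with b d show "(b, x) \<in> W" by blast
    qed
    show "\<exists>x. \<bar>x - g a\<bar> \<le> \<bar>g b - g a\<bar> \<and> F b (g b) - F b (g a) = (g b - g a) * Fs b x"
    proof (cases "g b" "g a" rule: linorder_cases)
      case less
      obtain x where "g b < x" "x < g a" "F b (g a) - F b (g b) = (g a - g b) * Fs b x"
        using MVT2[OF less, of "F b" "Fs b"] der by force
      then show ?thesis by (intro exI[of _ x]) (auto simp: algebra_simps)
    next
      case equal
      then show ?thesis by (intro exI[of _ "g a"]) auto
    next
      case greater
      obtain x where "g a < x" "x < g b" "F b (g b) - F b (g a) = (g b - g a) * Fs b x"
        using MVT2[OF greater, of "F b" "Fs b"] der by force
      then show ?thesis by (intro exI[of _ x]) auto
    qed
  qed
  then obtain \<xi> where \<xi>: "\<And>b. b \<in> ball a d \<Longrightarrow> g b \<in> ball (g a) d \<Longrightarrow>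
      \<bar>\<xi> b - g a\<bar> \<le> \<bar>g b - g a\<bar> \<and> F b (g b) - F b (g a) = (g b - g a) * Fs b (\<xi> b)"
    by metis
  have g_lim: "((\<lambda>b. \<bar>g b - g a\<bar>) \<longlongrightarrow> 0) (at a)"
    using g unfolding isCont_def by (intro tendsto_rabs_zero) (simp add: LIM_zero)
  have "((\<lambda>b. \<xi> b - g a) \<longlongrightarrow> 0) (at a)"
    by (rule Lim_null_comparison[OF _ g_lim]) (use near \<xi> in \<open>auto elim: eventually_mono\<close>)
  then have "((\<lambda>b. (b, \<xi> b)) \<longlongrightarrow> (a, g a)) (at a)"
    by (intro tendsto_Pair) (auto simp: LIM_zero_iff)
  then have Fs_lim: "((\<lambda>b. Fs b (\<xi> b)) \<longlongrightarrow> Fs a (g a)) (at a)"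
    using isCont_tendsto_compose[OF cont] by force
  have Fa_lim: "((\<lambda>b. (F b (g a) - F a (g a)) / (b - a)) \<longlongrightarrow> Fa) (at a)"
    using Fa by (simp add: has_field_derivative_iff)
  have "((\<lambda>b. - ((F b (g a) - F a (g a)) / (b - a)) / Fs b (\<xi> b)) \<longlongrightarrow> - Fa / Fs a (g a)) (at a)"
    by (intro tendsto_intros Fa_lim Fs_lim nz)
  moreover have "F a (g a) = 0"
    using eventually_nhds_x_imp_x[OF zero] .
  then have "\<forall>\<^sub>F b in at a. - ((F b (g a) - F a (g a)) / (b - a)) / Fs b (\<xi> b)
      = (g b - g a) / (b - a)"
  proof -
    have "\<forall>\<^sub>F b in at a. Fs b (\<xi> b) \<noteq> 0"
      using Fs_lim nz by (rule tendsto_imp_eventually_ne)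
    moreover have "\<forall>\<^sub>F b in at a. F b (g b) = 0"
      using zero by (auto simp: eventually_at_filter elim: eventually_mono)
    ultimately show ?thesis
      using near
    proof eventually_elim
      case (elim b)
      then have "- F b (g a) = (g b - g a) * Fs b (\<xi> b)" using \<xi>[of b] by auto
      then have "- F b (g a) / Fs b (\<xi> b) = g b - g a"
        using elim(1) by (simp add: field_simps)
      then show ?case using \<open>F a (g a) = 0\<close>
        by (metis (no_types, lifting) diff_zero divide_divide_eq_left minus_divide_left mult.commute)
    qed
  qed
  ultimately have "((\<lambda>b. (g b - g a) / (b - a)) \<longlongrightarrow> - Fa / Fs a (g a)) (at a)"
    by (rule Lim_transform_eventually)
  then show ?thesis by (simp add: has_field_derivative_iff)
qed

section \<open>Coefficients of the catenoid\<close>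

lemma cat_arg_pos:
  fixes a s :: real
  assumes "a > 1 / 2"
  shows "a * cosh (2 * s) - 1 / 2 > 0" "a * cosh (2 * s) + 1 / 2 > 0"
proof -
  have "a * cosh (2 * s) \<ge> a * 1"
    using assms by (intro mult_left_mono cosh_real_ge_1) auto
  then show "a * cosh (2 * s) - 1 / 2 > 0" "a * cosh (2 * s) + 1 / 2 > 0"
    using assms by linarith+
qed

lemma cat_K_arg_pos:
  fixes a :: real
  assumes "a > 1 / 2"
  shows "a\<^sup>2 - 1 / 4 > 0"
proof -
  have "a\<^sup>2 > (1 / 2)\<^sup>2"
    using assms by (intro power_strict_mono) auto
  then show ?thesis by (simp add: power2_eq_square)
qed

lemma cat_pos:
  assumes "a > 1 / 2"
  shows "cat_A a s > 0" "cat_B a s > 0"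
  using cat_arg_pos[OF assms] by (simp_all add: cat_A_def cat_B_def)

lemma cat_K_pos: "a > 1 / 2 \<Longrightarrow> cat_K a > 0"
  using cat_K_arg_pos by (simp add: cat_K_def)

lemma cat_squares:
  assumes "a > 1 / 2"
  shows "(cat_A a s)\<^sup>2 = a * cosh (2 * s) + 1 / 2"
    and "(cat_B a s)\<^sup>2 = a * cosh (2 * s) - 1 / 2"
  using cat_arg_pos[OF assms, of s] by (simp_all add: cat_A_def cat_B_def)

lemma cat_K_square: "a > 1 / 2 \<Longrightarrow> (cat_K a)\<^sup>2 = a\<^sup>2 - 1 / 4"
  using cat_K_arg_pos[of a] by (simp add: cat_K_def)

text \<open>
  This says that \<open>s\<close> is the arc length of the profile curve, whose squared speed is
  \<open>(S\<^sup>2 + K\<^sup>2) / (A\<^sup>2 B\<^sup>2)\<close>.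
\<close>
lemma sinh_cat_square:
  assumes "a > 1 / 2"
  shows "(a * sinh (2 * s))\<^sup>2 = (cat_A a s)\<^sup>2 * (cat_B a s)\<^sup>2 - (cat_K a)\<^sup>2"
  unfolding cat_squares[OF assms] cat_K_square[OF assms] power_mult_distrib sinh_square_eq
  by (simp add: algebra_simps power2_eq_square)

lemma cat_param_derivs:
  assumes "a > 1 / 2"
  shows "((\<lambda>b. cat_A b s) has_real_derivative cosh (2 * s) / (2 * cat_A a s)) (at a)"
    and "((\<lambda>b. cat_B b s) has_real_derivative cosh (2 * s) / (2 * cat_B a s)) (at a)"
    and "(cat_K has_real_derivative a / cat_K a) (at a)"
  unfolding cat_A_def cat_B_def cat_K_def
  using cat_arg_pos[OF assms, of s] cat_K_arg_pos[OF assms]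
  by (auto intro!: derivative_eq_intros simp: field_simps)

lemma cat_space_derivs:
  assumes "a > 1 / 2"
  shows "(cat_A a has_real_derivative a * sinh (2 * s) / cat_A a s) (at s)"
    and "(cat_B a has_real_derivative a * sinh (2 * s) / cat_B a s) (at s)"
  unfolding cat_A_def cat_B_def
  using cat_arg_pos[OF assms, of s] cat_K_arg_pos[OF assms]
  by (auto intro!: derivative_eq_intros simp: field_simps)

section \<open>The angle and its derivatives\<close>

definition slope :: "real \<Rightarrow> real \<Rightarrow> real" where
  "slope a t = cat_K a / ((cat_A a t)\<^sup>2 * cat_B a t)"

text \<open>
  The second factor is the logarithmic derivative of \<open>K / (A\<^sup>2 B)\<close> in the parameter.
\<close>
definition slope_param :: "real \<Rightarrow> real \<Rightarrow> real" where
  "slope_param a t = slope a t *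
     (a / (cat_K a)\<^sup>2 - cosh (2 * t) / (cat_A a t)\<^sup>2 - cosh (2 * t) / (2 * (cat_B a t)\<^sup>2))"

lemma slope_pos: "a > 1 / 2 \<Longrightarrow> slope a t > 0"
  using cat_pos[of a t] cat_K_pos[of a] by (simp add: slope_def)

lemma slope_has_param_derivative:
  assumes "a > 1 / 2"
  shows "((\<lambda>b. slope b t) has_real_derivative slope_param a t) (at a)"
proof -
  note [derivative_intros] = cat_param_derivs[OF assms]
  show ?thesis
    unfolding slope_def slope_param_def
    using cat_pos[OF assms, of t] cat_K_pos[OF assms]
    by (auto intro!: derivative_eq_intros simp: field_simps power2_eq_square)
qed

lemma continuous_on_cat [continuous_intros]:
  assumes "continuous_on S f" "continuous_on S g"
  shows "continuous_on S (\<lambda>x. cat_A (f x) (g x))"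
    and "continuous_on S (\<lambda>x. cat_B (f x) (g x))"
    and "continuous_on S (\<lambda>x. cat_K (f x))"
  unfolding cat_A_def cat_B_def cat_K_def by (intro continuous_intros assms)+

lemma continuous_on_slope: "a > 1 / 2 \<Longrightarrow> continuous_on S (slope a)"
  unfolding slope_def
  using cat_pos cat_K_pos by (intro continuous_intros) (auto simp: less_imp_neq[symmetric])

lemma continuous_on_slope_param: "continuous_on ({1 / 2<..} \<times> S) (\<lambda>(a, t). slope_param a t)"
  unfolding slope_param_def slope_def split_def
  using cat_pos cat_K_pos by (intro continuous_intros) (auto simp: less_imp_neq[symmetric])

text \<open>
  For \<open>s \<ge> 0\<close> the oriented Lebesgue integral is a Henstock--Kurzweil integral, for which the
  fundamental theorem and the Leibniz rule are stated.
\<close>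
lemma cat_phi_eq_integral:
  assumes "a > 1 / 2" "s \<ge> 0"
  shows "cat_phi a s = integral {0..s} (slope a)"
  unfolding cat_phi_def slope_def[symmetric]
  by (intro interval_integral_eq_integral borel_integrable_atLeastAtMost' continuous_on_slope)
     (use assms in auto)

lemma cat_phi_has_space_derivative:
  assumes "a > 1 / 2" "s > 0"
  shows "(cat_phi a has_real_derivative slope a s) (at s)"
proof -
  have "((\<lambda>x. integral {0..x} (slope a)) has_real_derivative slope a s) (at s within {0..s+1})"
    using assms by (intro integral_has_real_derivative continuous_on_slope) auto
  then have "((\<lambda>x. integral {0..x} (slope a)) has_real_derivative slope a s) (at s)"
    using at_within_interior[of s "{0..s+1}"] assms by simp
  then show ?thesis
    by (rule has_field_derivative_transform_within_open[of _ _ _ "{0<..}"])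
       (use assms in \<open>auto simp: cat_phi_eq_integral\<close>)
qed

definition cat_phi_param :: "real \<Rightarrow> real \<Rightarrow> real" where
  "cat_phi_param a s = integral {0..s} (slope_param a)"

lemma cat_phi_has_param_derivative:
  assumes "a > 1 / 2" "s \<ge> 0"
  shows "((\<lambda>b. cat_phi b s) has_real_derivative cat_phi_param a s) (at a)"
proof -
  have "((\<lambda>b. integral (cbox 0 s) (slope b)) has_real_derivative
      integral (cbox 0 s) (slope_param a)) (at a within {1 / 2<..})"
  proof (rule leibniz_rule_field_derivative)
    show "((\<lambda>b. slope b t) has_real_derivative slope_param b t) (at b within {1 / 2<..})"
      if "b \<in> {1 / 2<..}" for b t
      using that by (auto intro: has_field_derivative_at_within[OF slope_has_param_derivative])
    show "slope b integrable_on cbox 0 s" if "b \<in> {1 / 2<..}" for b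
      using that by (intro integrable_continuous continuous_on_slope) simp
    show "continuous_on ({1 / 2<..} \<times> cbox 0 s) (\<lambda>(b, t). slope_param b t)"
      by (rule continuous_on_slope_param)
  qed (use assms in auto)
  then have "((\<lambda>b. integral {0..s} (slope b)) has_real_derivative cat_phi_param a s) (at a)"
    using assms by (simp add: cat_phi_param_def at_within_open[of a "{1 / 2<..}"])
  then show ?thesis
    by (rule has_field_derivative_transform_within_open[of _ _ _ "{1 / 2<..}"])
       (use assms in \<open>auto simp: cat_phi_eq_integral\<close>)
qed

lemma cat_phi_param_has_space_derivative:
  assumes "a > 1 / 2" "s > 0"
  shows "(cat_phi_param a has_real_derivative slope_param a s) (at s)"
proof -
  have "continuous_on {0..s+1} (slope_param a)"
    using continuous_on_compose2[OF continuous_on_slope_param[of "{0..s+1}"]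
        continuous_on_Pair[OF continuous_on_const[of _ a] continuous_on_id[of "{0..s+1}"]]] assms(1)
    by (simp add: image_subset_iff)
  then have "(cat_phi_param a has_real_derivative slope_param a s) (at s within {0..s+1})"
    unfolding cat_phi_param_def using assms by (intro integral_has_real_derivative) auto
  then show ?thesis
    using at_within_interior[of s "{0..s+1}"] assms by simp
qed

section \<open>The contact parameter\<close>

text \<open>
  The value of \<open>tanh \<phi>\<close> that makes the normal orthogonal to the time axis.  Since
  \<open>1 - contact\<^sup>2\<close> has the sign of \<open>B\<^sup>2 - K\<^sup>2\<close>, contact can only happen where \<open>B > K\<close>.
\<close>
definition contact :: "real \<Rightarrow> real \<Rightarrow> real" where
  "contact a s = cat_B a s * cat_K a / (a * sinh (2 * s))"

lemma contact_pos: "a > 1 / 2 \<Longrightarrow> s > 0 \<Longrightarrow> contact a s > 0"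
  using cat_pos[of a s] cat_K_pos[of a] by (simp add: contact_def)

lemma one_minus_contact_square:
  assumes "a > 1 / 2" "s > 0"
  shows "1 - (contact a s)\<^sup>2
    = (cat_A a s)\<^sup>2 * ((cat_B a s)\<^sup>2 - (cat_K a)\<^sup>2) / (a * sinh (2 * s))\<^sup>2"
proof -
  have nz: "(a * sinh (2 * s))\<^sup>2 \<noteq> 0" using assms by simp
  have A: "(cat_A a s)\<^sup>2 = (cat_B a s)\<^sup>2 + 1"
    using cat_squares[OF assms(1), of s] by simp
  have "1 - (contact a s)\<^sup>2
      = ((a * sinh (2 * s))\<^sup>2 - (cat_B a s)\<^sup>2 * (cat_K a)\<^sup>2) / (a * sinh (2 * s))\<^sup>2"
    using nz by (simp add: contact_def power_divide power_mult_distrib diff_divide_distrib)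
  also have "(a * sinh (2 * s))\<^sup>2 - (cat_B a s)\<^sup>2 * (cat_K a)\<^sup>2
      = (cat_A a s)\<^sup>2 * ((cat_B a s)\<^sup>2 - (cat_K a)\<^sup>2)"
    unfolding sinh_cat_square[OF assms(1)] A by (simp add: algebra_simps)
  finally show ?thesis .
qed

lemma contact_less_one_iff:
  assumes "a > 1 / 2" "s > 0"
  shows "contact a s < 1 \<longleftrightarrow> (cat_B a s)\<^sup>2 > (cat_K a)\<^sup>2"
proof -
  have "contact a s < 1 \<longleftrightarrow> 0 < 1 - (contact a s)\<^sup>2"
    using contact_pos[OF assms] by (simp add: power_less_one_iff)
  also have "\<dots> \<longleftrightarrow> (cat_B a s)\<^sup>2 > (cat_K a)\<^sup>2"
    unfolding one_minus_contact_square[OF assms]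
    using assms cat_pos[OF assms(1), of s] cat_K_pos[OF assms(1)] by (simp add: zero_less_divide_iff zero_less_mult_iff)
  finally show ?thesis .
qed

text \<open>
  In both partial derivatives of \<open>contact\<close> the second factor is the logarithmic derivative.
\<close>
definition contact_space :: "real \<Rightarrow> real \<Rightarrow> real" where
  "contact_space a s = contact a s *
     (a * sinh (2 * s) / (cat_B a s)\<^sup>2 - 2 * a * cosh (2 * s) / (a * sinh (2 * s)))"

definition contact_param :: "real \<Rightarrow> real \<Rightarrow> real" where
  "contact_param a s = contact a s *
     (a / (cat_K a)\<^sup>2 + cosh (2 * s) / (2 * (cat_B a s)\<^sup>2) - 1 / a)"

lemma contact_has_space_derivative:
  assumes "a > 1 / 2" "s > 0"
  shows "(contact a has_real_derivative contact_space a s) (at s)"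
proof -
  note [derivative_intros] = cat_space_derivs[OF assms(1)]
  have "sinh (2 * s) > 0" using assms by simp
  then show ?thesis
    unfolding contact_def contact_space_def
    using cat_pos[OF assms(1), of s] cat_K_pos[OF assms(1)] assms(1)
    by (auto intro!: derivative_eq_intros simp: field_simps power2_eq_square)
qed

lemma contact_has_param_derivative:
  assumes "a > 1 / 2" "s > 0"
  shows "((\<lambda>b. contact b s) has_real_derivative contact_param a s) (at a)"
proof -
  note [derivative_intros] = cat_param_derivs[OF assms(1)]
  have "sinh (2 * s) > 0" using assms by simp
  then show ?thesis
    unfolding contact_def contact_param_def
    using cat_pos[OF assms(1), of s] cat_K_pos[OF assms(1)] assms(1)
    by (auto intro!: derivative_eq_intros simp: field_simps power2_eq_square)
qed

text \<open>
  The closed form makes it evident that \<open>contact\<close> decreases in \<open>s\<close>.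
\<close>
lemma contact_space_eq:
  assumes "a > 1 / 2" "s > 0"
  shows "contact_space a s
    = - cat_K a * ((cat_B a s) ^ 4 + (cat_K a)\<^sup>2)
        / (cat_B a s * (a * sinh (2 * s))\<^sup>2)"
proof -
  define S where "S = a * sinh (2 * s)"
  have S: "S > 0" using assms by (simp add: S_def)
  have S2: "S\<^sup>2 = ((cat_B a s)\<^sup>2 + 1) * (cat_B a s)\<^sup>2 - (cat_K a)\<^sup>2"
    using sinh_cat_square[OF assms(1), of s] cat_squares[OF assms(1), of s] by (simp add: S_def)
  have C: "a * cosh (2 * s) = (cat_B a s)\<^sup>2 + 1 / 2"
    using cat_squares[OF assms(1), of s] by simp
  have "contact_space a s
      = cat_K a * (S\<^sup>2 - 2 * (a * cosh (2 * s)) * (cat_B a s)\<^sup>2) / (cat_B a s * S\<^sup>2)"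
    unfolding contact_space_def contact_def S_def[symmetric]
    using S cat_pos[OF assms(1), of s] cat_K_pos[OF assms(1)] by (simp add: field_simps power2_eq_square)
  also have "S\<^sup>2 - 2 * (a * cosh (2 * s)) * (cat_B a s)\<^sup>2 = - ((cat_B a s) ^ 4 + (cat_K a)\<^sup>2)"
    unfolding C S2 by (simp add: algebra_simps power2_eq_square power4_eq_xxxx)
  finally show ?thesis by (simp add: S_def algebra_simps)
qed

definition contact_defect :: "real \<Rightarrow> real \<Rightarrow> real" where
  "contact_defect a s = tanh (cat_phi a s) - contact a s"

lemma contact_defect_strict_mono:
  assumes "a > 1 / 2"
  shows "strict_mono_on {0<..} (contact_defect a)"
proof (rule strict_mono_onI)
  fix x y :: real assume xy: "x \<in> {0<..}" "y \<in> {0<..}" "x < y"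
  show "contact_defect a x < contact_defect a y"
  proof (rule DERIV_pos_imp_increasing[OF xy(3)])
    fix s assume "x \<le> s" "s \<le> y"
    then have s: "s > 0" using xy by auto
    have "(contact_defect a has_real_derivative
        (1 - (tanh (cat_phi a s))\<^sup>2) * slope a s - contact_space a s) (at s)"
      unfolding contact_defect_def
      by (auto intro!: derivative_eq_intros cat_phi_has_space_derivative[OF assms s]
          contact_has_space_derivative[OF assms s])
    moreover have "(1 - (tanh (cat_phi a s))\<^sup>2) * slope a s > 0"
      using tanh_real_bounds[of "cat_phi a s"] slope_pos[OF assms, of s]
      by (simp add: abs_square_less_1 abs_less_iff)
    moreover have "contact_space a s < 0"
      unfolding contact_space_eq[OF assms s]
      using s assms cat_pos[OF assms, of s] cat_K_pos[OF assms]
      by (auto simp: divide_less_0_iff mult_less_0_iff add_pos_pos)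
    ultimately show "\<exists>D. (contact_defect a has_real_derivative D) (at s) \<and> 0 < D"
      by (intro exI[of _ "(1 - (tanh (cat_phi a s))\<^sup>2) * slope a s - contact_space a s"] conjI) linarith+
  qed
qed

text \<open>
  The defect is nonpositive where \<open>B = K\<close>, because there \<open>contact = 1\<close>.  For large \<open>s\<close> it
  is nonnegative, because \<open>contact\<^sup>2 \<le> 4 a / C\<close> tends to zero while \<open>tanh \<phi>\<close> increases.
\<close>
lemma contact_defect_has_zero:
  assumes "a > 1 / 2"
  shows "\<exists>s>0. contact_defect a s = 0"
proof -
  have cosh_surj: "\<exists>s>0. cosh (2 * s) = x" if "x > 1" for x :: real
    using that by (intro exI[of _ "arcosh x / 2"]) auto
  (* B^2 = K^2 amounts to cosh (2 l) = a + 1 / (4 a). *)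
  have "(a - 1 / 2)\<^sup>2 > 0" using assms by simp
  then have "a + 1 / (4 * a) > 1"
    using assms by (simp add: field_simps power2_eq_square)
  then obtain l where l: "l > 0" "cosh (2 * l) = a + 1 / (4 * a)"
    using cosh_surj by blast
  have "(cat_B a l)\<^sup>2 = (cat_K a)\<^sup>2"
    using assms unfolding cat_squares[OF assms] cat_K_square[OF assms] l(2) by (simp add: field_simps power2_eq_square)
  then have "\<not> contact a l < 1" using contact_less_one_iff[OF assms l(1)] by simp
  then have neg: "contact_defect a l \<le> 0"
    using tanh_real_lt_1[of "cat_phi a l"] by (simp add: contact_defect_def)
  define c where "c = tanh (cat_phi a l)"
  have phi_mono: "cat_phi a x \<le> cat_phi a y" if "0 < x" "x \<le> y" for x y
    using cat_phi_has_space_derivative[OF assms] slope_pos[OF assms] that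
    by (intro DERIV_nonneg_imp_nondecreasing[OF that(2)]) (meson less_imp_le order_less_le_trans)
  have "cat_phi a l > 0"
  proof -
    have "integral {0..l} (slope a) > 0"
      using integral_less_real[of 0 l "\<lambda>_. 0" "slope a"] l slope_pos[OF assms]
        continuous_on_slope[OF assms] by simp
    then show ?thesis using assms l by (simp add: cat_phi_eq_integral)
  qed
  then have c: "c > 0" by (simp add: c_def)
  (* M is large enough for 4 a / M <= c^2, for M^2 - 1 >= M^2 / 4, and for r not to lie below l. *)
  define M where "M = max (cosh (2 * l)) (max 2 (4 * a / c\<^sup>2))"
  have M: "M \<ge> 2" "M \<ge> 4 * a / c\<^sup>2" "M \<ge> cosh (2 * l)" by (auto simp: M_def)
  have "M > 1" using M(1) by linarith
  then obtain r where r: "r > 0" "cosh (2 * r) = M"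
    using cosh_surj by blast
  have lr: "l \<le> r"
    using M(3) l(1) r(1) unfolding r(2)[symmetric] by (simp add: cosh_real_nonneg_le_iff)
  have "(contact a r)\<^sup>2 \<le> c\<^sup>2"
  proof -
    have "(contact a r)\<^sup>2 = (a * M - 1 / 2) * (a\<^sup>2 - 1 / 4) / (a\<^sup>2 * (M\<^sup>2 - 1))"
      unfolding contact_def power_divide power_mult_distrib cat_squares[OF assms] cat_K_square[OF assms]
      by (simp add: sinh_square_eq r)
    also have "\<dots> \<le> (a * M) * a\<^sup>2 / (a\<^sup>2 * (M\<^sup>2 / 4))"
    proof (rule frac_le)
      have "M\<^sup>2 \<ge> 2\<^sup>2" using M by (intro power_mono) auto
      then show "a\<^sup>2 * (M\<^sup>2 / 4) \<le> a\<^sup>2 * (M\<^sup>2 - 1)"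
        by (intro mult_left_mono) auto
      show "(a * M - 1 / 2) * (a\<^sup>2 - 1 / 4) \<le> a * M * a\<^sup>2"
        using cat_K_arg_pos[OF assms] assms M by (intro mult_mono) auto
    qed (use assms M in auto)
    also have "\<dots> = 4 * a / M"
      using assms M by (simp add: field_simps power2_eq_square)
    also have "\<dots> \<le> c\<^sup>2"
      using M c by (simp add: field_simps)
    finally show ?thesis .
  qed
  then have "contact a r \<le> c"
    by (rule power2_le_imp_le) (use c in simp)
  also have "c \<le> tanh (cat_phi a r)"
    using phi_mono[OF l(1) lr] by (simp add: c_def)
  finally have pos: "contact_defect a r \<ge> 0" by (simp add: contact_defect_def)
  have "isCont (contact_defect a) s" if "s \<in> {l..r}" for s
  proof -
    have "s > 0" using that l(1) by simp
    note ders = cat_phi_has_space_derivative[OF assms this] contact_has_space_derivative[OF assms this]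
    show ?thesis
      unfolding contact_defect_def by (intro continuous_intros ders[THEN DERIV_isCont]) simp
  qed
  then have "continuous_on {l..r} (contact_defect a)"
    by (intro continuous_at_imp_continuous_on) blast
  then obtain s where "l \<le> s" "contact_defect a s = 0"
    using IVT'[of "contact_defect a" l 0 r] neg pos lr by blast
  with l show ?thesis by (intro exI[of _ s]) auto
qed

lemma cat_s0:
  assumes "a > 1 / 2"
  shows cat_s0_pos: "cat_s0 a > 0"
    and tanh_phi_s0: "tanh (cat_phi a (cat_s0 a)) = contact a (cat_s0 a)"
proof -
  have "\<exists>!s. s > 0 \<and> tanh (cat_phi a s) = contact a s"
  proof (rule ex_ex1I)
    show "\<exists>s. s > 0 \<and> tanh (cat_phi a s) = contact a s"
      using contact_defect_has_zero[OF assms] by (auto simp: contact_defect_def)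
    fix s t assume "s > 0 \<and> tanh (cat_phi a s) = contact a s" "t > 0 \<and> tanh (cat_phi a t) = contact a t"
    then show "s = t"
      using strict_mono_on_eqD[OF contact_defect_strict_mono[OF assms], of s t]
      by (auto simp: contact_defect_def)
  qed
  from theI'[OF this]
  show "cat_s0 a > 0" "tanh (cat_phi a (cat_s0 a)) = contact a (cat_s0 a)"
    unfolding cat_s0_def contact_def by auto
qed

lemma B_s0_gt_K:
  assumes "a > 1 / 2"
  shows "(cat_B a (cat_s0 a))\<^sup>2 > (cat_K a)\<^sup>2"
  using contact_less_one_iff[OF assms cat_s0_pos[OF assms]] tanh_real_lt_1 tanh_phi_s0[OF assms]
  by metis

lemma isCont_cat_s0:
  assumes "a > 1 / 2"
  shows "isCont cat_s0 a"
proof (rule isCont_implicit_zero[where L = 0 and F = contact_defect and U = "{1 / 2<..}"])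
  have "\<forall>\<^sub>F b in nhds a. b > 1 / 2"
    using assms by (intro eventually_nhds_in_open[of "{1 / 2<..}", simplified]) auto
  then show "\<forall>\<^sub>F b in nhds a. 0 < cat_s0 b \<and> contact_defect b (cat_s0 b) = 0"
    by eventually_elim (use cat_s0 in \<open>auto simp: contact_defect_def\<close>)
  show "isCont (\<lambda>b. contact_defect b s) a" if "s > 0" for s
    unfolding contact_defect_def
    using assms that
    by (intro continuous_intros DERIV_isCont[OF cat_phi_has_param_derivative]
          DERIV_isCont[OF contact_has_param_derivative]) auto
qed (use assms contact_defect_strict_mono in auto)

text \<open>
  This is \<open>- F\<^sub>a / F\<^sub>s\<close> for \<open>F a s = cat_phi a s - artanh (contact a s)\<close>, evaluated at the zero of \<open>F a\<close>.
\<close>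
definition cat_s0_deriv :: "real \<Rightarrow> real" where
  "cat_s0_deriv a = (let s = cat_s0 a in
    - (cat_phi_param a s - contact_param a s / (1 - (contact a s)\<^sup>2))
      / (cat_B a s * cat_K a / ((cat_B a s)\<^sup>2 - (cat_K a)\<^sup>2)))"

text \<open>
  Near the contact parameter the condition \<open>tanh \<phi> = contact\<close> may be replaced by
  \<open>\<phi> = artanh contact\<close>.  The gain is that the \<open>s\<close>-derivative of \<open>\<phi> - artanh contact\<close>
  collapses to the elementary function \<open>B K / (B\<^sup>2 - K\<^sup>2)\<close>, in which \<open>\<phi>\<close> no longer occurs.  It is
  visibly positive and jointly continuous, as the implicit function argument requires.
\<close>
lemma cat_s0_has_derivative:
  assumes a: "a > 1 / 2"
  shows "(cat_s0 has_real_derivative cat_s0_deriv a) (at a)"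
proof -
  define s where "s = cat_s0 a"
  define F where "F b t = cat_phi b t - artanh (contact b t)" for b t
  define Fs where "Fs b t = cat_B b t * cat_K b / ((cat_B b t)\<^sup>2 - (cat_K b)\<^sup>2)" for b t
  define W where "W = {x::real \<times> real. fst x > 1 / 2 \<and> snd x > 0 \<and>
    (cat_K (fst x))\<^sup>2 < (cat_B (fst x) (snd x))\<^sup>2}"
  have "(cat_s0 has_real_derivative
    - (cat_phi_param a s - contact_param a s / (1 - (contact a s)\<^sup>2)) / Fs a (cat_s0 a)) (at a)"
  proof (rule implicit_zero_has_real_derivative[where F = F and W = W])
    have "\<forall>\<^sub>F b in nhds a. b > 1 / 2"
      using a by (intro eventually_nhds_in_open[of "{1 / 2<..}", simplified]) auto
    then show "\<forall>\<^sub>F b in nhds a. F b (cat_s0 b) = 0"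
      by eventually_elim (simp add: F_def artanh_tanh_real flip: tanh_phi_s0)
    show "isCont cat_s0 a" by (rule isCont_cat_s0[OF a])
    have s: "s > 0" and u: "\<bar>contact a s\<bar> < 1"
      using cat_s0_pos[OF a] tanh_real_bounds[of "cat_phi a (cat_s0 a)"] tanh_phi_s0[OF a] by (auto simp: s_def)
    show "((\<lambda>b. F b (cat_s0 a)) has_real_derivative
        cat_phi_param a s - contact_param a s / (1 - (contact a s)\<^sup>2)) (at a)"
      unfolding F_def s_def[symmetric]
      using DERIV_diff[OF cat_phi_has_param_derivative[OF a less_imp_le[OF s]]
          DERIV_chain2[where f = artanh and g = "\<lambda>b. contact b s",
            OF artanh_real_has_field_derivative[OF u] contact_has_param_derivative[OF a s]]]
      by simp
    have "W = ({1 / 2<..} \<times> {0<..}) \<inter> {x. (cat_K (fst x))\<^sup>2 < (cat_B (fst x) (snd x))\<^sup>2}"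
      by (auto simp: W_def)
    also have "open \<dots>"
      by (intro open_Int open_Times open_Collect_less continuous_intros) auto
    finally show "open W" .
    show aW: "(a, cat_s0 a) \<in> W"
      using a cat_s0_pos[OF a] B_s0_gt_K[OF a] by (simp add: W_def)
    show "(F b has_real_derivative Fs b t) (at t)" if bt: "(b, t) \<in> W" for b t
    proof -
      from bt have b: "b > 1 / 2" and t: "t > 0" and gt: "(cat_K b)\<^sup>2 < (cat_B b t)\<^sup>2"
        by (auto simp: W_def)
      have u: "\<bar>contact b t\<bar> < 1"
        using contact_less_one_iff[OF b t] contact_pos[OF b t] gt by simp
      have "(F b has_real_derivative slope b t - contact_space b t / (1 - (contact b t)\<^sup>2)) (at t)"
        unfolding F_def
        using DERIV_diff[OF cat_phi_has_space_derivative[OF b t]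
            DERIV_chain2[where f = artanh and g = "contact b",
              OF artanh_real_has_field_derivative[OF u] contact_has_space_derivative[OF b t]]]
        by simp
      also have "slope b t - contact_space b t / (1 - (contact b t)\<^sup>2) = Fs b t"
      proof -
        define Q G S where "Q = (cat_B b t)\<^sup>2" and "G = (cat_B b t)\<^sup>2 - (cat_K b)\<^sup>2"
          and "S = b * sinh (2 * t)"
        have A: "(cat_A b t)\<^sup>2 = Q + 1"
          using cat_squares[OF b, of t] by (simp add: Q_def)
        have B4: "cat_B b t ^ 4 = Q\<^sup>2" by (simp add: Q_def power_mult[symmetric])
        have pos: "S > 0" "G > 0" "Q + 1 > 0" "cat_B b t > 0"
          using b t gt cat_pos[OF b, of t] by (auto simp: S_def G_def Q_def add_nonneg_pos)
        have "contact_space b t / (1 - (contact b t)\<^sup>2)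
            = - (cat_K b * (Q\<^sup>2 + (cat_K b)\<^sup>2) / (cat_B b t * ((Q + 1) * G)))"
          unfolding contact_space_eq[OF b t] one_minus_contact_square[OF b t] A B4
            G_def[symmetric] S_def[symmetric]
          using pos by simp
        then have "slope b t - contact_space b t / (1 - (contact b t)\<^sup>2)
            = cat_K b * (G + (Q\<^sup>2 + (cat_K b)\<^sup>2)) / (cat_B b t * ((Q + 1) * G))"
          unfolding slope_def A using pos by (simp add: distrib_left add_divide_distrib) (simp add: algebra_simps)
        also have "G + (Q\<^sup>2 + (cat_K b)\<^sup>2) = (Q + 1) * (cat_B b t * cat_B b t)"
          unfolding G_def Q_def by (simp add: power2_eq_square algebra_simps)
        finally show ?thesis
          unfolding Fs_def G_def[symmetric] using pos by simp
      qed
      finally show ?thesis .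
    qed
    show "isCont (\<lambda>(b, t). Fs b t) (a, cat_s0 a)"
    proof -
      have "continuous_on W (\<lambda>(b, t). Fs b t)"
        unfolding Fs_def split_def by (intro continuous_intros) (auto simp: W_def)
      with \<open>open W\<close> aW show ?thesis by (simp add: continuous_on_eq_continuous_at)
    qed
    show "Fs a (cat_s0 a) \<noteq> 0"
      using cat_pos[OF a] cat_K_pos[OF a] B_s0_gt_K[OF a] by (simp add: Fs_def less_imp_neq[symmetric])
  qed
  then show ?thesis by (simp add: Fs_def s_def cat_s0_deriv_def Let_def)
qed

section \<open>The radius of the supporting ball\<close>

lemma cat_r_pos_cosh:
  assumes "a > 1 / 2"
  shows cat_r_pos: "cat_r a > 0"
    and cosh_cat_r: "cosh (cat_r a) = cat_A a (cat_s0 a) * cosh (cat_phi a (cat_s0 a))"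
proof -
  define x where "x = cat_A a (cat_s0 a) * cosh (cat_phi a (cat_s0 a))"
  have "(cat_A a (cat_s0 a))\<^sup>2 > 1\<^sup>2"
    using cat_arg_pos(1)[OF assms, of "cat_s0 a"] cat_squares(1)[OF assms] by simp
  then have "cat_A a (cat_s0 a) > 1"
    using cat_pos(1)[OF assms] by (intro power_less_imp_less_base[of 1 2]) (auto intro: less_imp_le)
  moreover have "cat_A a (cat_s0 a) * 1 \<le> x"
    unfolding x_def using cat_pos(1)[OF assms] by (intro mult_left_mono cosh_real_ge_1 less_imp_le)
  ultimately have "x > 1" by linarith
  then have "\<exists>!r. r > 0 \<and> cosh r = x"
    by (intro ex1I[of _ "arcosh x"]) (auto simp: arcosh_cosh_real)
  from theI'[OF this] show "cat_r a > 0"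
    "cosh (cat_r a) = cat_A a (cat_s0 a) * cosh (cat_phi a (cat_s0 a))"
    unfolding cat_r_def x_def by auto
qed

lemma cat_y_gt_one: "a > 1 / 2 \<Longrightarrow> cat_y a > 1"
  using B_s0_gt_K[of a] cat_K_pos[of a] by (simp add: cat_y_def)

text \<open>
  With \<open>tanh \<phi> = K B / S\<close> the angle disappears:
  \<open>cosh\<^sup>2 r = A\<^sup>2 / (1 - tanh\<^sup>2 \<phi>) = S\<^sup>2 / (B\<^sup>2 - K\<^sup>2)\<close>, and
  \<open>S\<^sup>2 - B\<^sup>2 + K\<^sup>2 = B\<^sup>4\<close>.
\<close>
lemma sinh_cat_r:
  assumes a: "a > 1 / 2"
  shows "sinh (cat_r a) / cat_K a = cat_y a / sqrt (cat_y a - 1)"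
proof -
  define s where "s = cat_s0 a"
  have s: "s > 0" and gt: "(cat_B a s)\<^sup>2 > (cat_K a)\<^sup>2"
    using cat_s0_pos[OF a] B_s0_gt_K[OF a] by (auto simp: s_def)
  have A: "(cat_A a s)\<^sup>2 = (cat_B a s)\<^sup>2 + 1"
    using cat_squares[OF a, of s] by simp
  define S where "S = a * sinh (2 * s)"
  have "S > 0" using a s by (simp add: S_def)
  note pos = this gt cat_pos[OF a, of s] cat_K_pos[OF a]
  have "1 - (tanh (cat_phi a s))\<^sup>2
      = ((cosh (cat_phi a s))\<^sup>2 - (sinh (cat_phi a s))\<^sup>2) / (cosh (cat_phi a s))\<^sup>2"
    by (simp add: tanh_def power_divide diff_divide_distrib)
  then have "1 - (tanh (cat_phi a s))\<^sup>2 = 1 / (cosh (cat_phi a s))\<^sup>2"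
    by (simp add: hyperbolic_pythagoras)
  then have "1 / (cosh (cat_phi a s))\<^sup>2
      = (cat_A a s)\<^sup>2 * ((cat_B a s)\<^sup>2 - (cat_K a)\<^sup>2) / S\<^sup>2"
    using one_minus_contact_square[OF a s] tanh_phi_s0[OF a] by (simp add: s_def S_def)
  from arg_cong[OF this, of inverse]
  have "(cosh (cat_phi a s))\<^sup>2 = S\<^sup>2 / ((cat_A a s)\<^sup>2 * ((cat_B a s)\<^sup>2 - (cat_K a)\<^sup>2))"
    by simp
  then have "(cosh (cat_r a))\<^sup>2 = S\<^sup>2 / ((cat_B a s)\<^sup>2 - (cat_K a)\<^sup>2)"
    using pos by (simp add: cosh_cat_r[OF a] s_def[symmetric] power_mult_distrib)
  then have "(sinh (cat_r a))\<^sup>2 = (S\<^sup>2 - ((cat_B a s)\<^sup>2 - (cat_K a)\<^sup>2)) / ((cat_B a s)\<^sup>2 - (cat_K a)\<^sup>2)"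
  proof -
    define G where "G = (cat_B a s)\<^sup>2 - (cat_K a)\<^sup>2"
    assume "(cosh (cat_r a))\<^sup>2 = S\<^sup>2 / ((cat_B a s)\<^sup>2 - (cat_K a)\<^sup>2)"
    then show ?thesis
      unfolding G_def[symmetric] using gt G_def by (simp add: sinh_square_eq diff_divide_distrib)
  qed
  also have "S\<^sup>2 - ((cat_B a s)\<^sup>2 - (cat_K a)\<^sup>2) = ((cat_B a s)\<^sup>2)\<^sup>2"
    unfolding S_def sinh_cat_square[OF a] A by (simp add: algebra_simps power2_eq_square)
  finally have sinh2: "(sinh (cat_r a))\<^sup>2
    = ((cat_B a s)\<^sup>2)\<^sup>2 / ((cat_B a s)\<^sup>2 - (cat_K a)\<^sup>2)" .
  have "(sinh (cat_r a) / cat_K a)\<^sup>2 = (cat_y a)\<^sup>2 / (cat_y a - 1)"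
  proof -
    define y k where "y = cat_y a" and "k = (cat_K a)\<^sup>2"
    have yk: "(cat_B a s)\<^sup>2 = y * k" "y > 1" "k > 0"
      using cat_y_gt_one[OF a] pos by (simp_all add: y_def k_def cat_y_def s_def)
    have "(sinh (cat_r a) / cat_K a)\<^sup>2 = (y * k)\<^sup>2 / ((y - 1) * k) / k"
      by (simp add: power_divide sinh2 yk(1) k_def[symmetric] algebra_simps)
    also have "\<dots> = y\<^sup>2 / (y - 1)"
      using yk(2,3) by (simp add: power2_eq_square)
    finally show ?thesis by (simp add: y_def)
  qed
  also have "\<dots> = (cat_y a / sqrt (cat_y a - 1))\<^sup>2"
    using cat_y_gt_one[OF a] by (simp add: power_divide)
  finally have "(sinh (cat_r a) / cat_K a)\<^sup>2 = (cat_y a / sqrt (cat_y a - 1))\<^sup>2" .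
  then show ?thesis
    by (rule power2_eq_imp_eq) (use cat_r_pos[OF a] cat_y_gt_one[OF a] pos in auto)
qed

section \<open>The Jacobi field at the boundary\<close>

text \<open>
  The parametric Jacobi field as a function of \<open>s\<close>; lemma \<open>cat_jacobi_eq\<close> establishes the
  agreement for \<open>s \<ge> 0\<close>.
\<close>
definition jacobi_profile :: "real \<Rightarrow> real \<Rightarrow> real" where
  "jacobi_profile a s = cat_K a * cosh (2 * s) / (2 * (cat_A a s)\<^sup>2 * (cat_B a s)\<^sup>2)
     - a * sinh (2 * s) / cat_B a s * cat_phi_param a s"

text \<open>
  With \<open>Q = B\<^sup>2\<close> and \<open>k = K\<^sup>2\<close>, the left-hand side collects the terms of \<open>y'\<close> that are free
  of \<open>\<partial>\<^sub>a\<phi>\<close>, and the right-hand side is the term \<open>K C / (2 A\<^sup>2 B\<^sup>2)\<close> of the Jacobi field, both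
  cleared of a common factor.
\<close>
lemma boundary_identity:
  fixes a C Q k :: real
  assumes "a * C = Q + 1 / 2" "k = a\<^sup>2 - 1 / 4" "a > 0" "k > 0"
  shows "(C - 2 * a * Q / k) * Q * (Q + 1) + (2 * Q * (a / k - 1 / a) + C) * ((Q + 1) * Q - k)
    = C * (Q - k)"
proof -
  have C: "C = (Q + 1 / 2) / a" using assms by (simp add: field_simps)
  have a2: "a\<^sup>2 = k + 1 / 4" using assms by simp
  have "a * k * ((C - 2 * a * Q / k) * Q * (Q + 1)
      + (2 * Q * (a / k - 1 / a) + C) * ((Q + 1) * Q - k) - C * (Q - k))
    = ((Q + 1 / 2) * k - 2 * a\<^sup>2 * Q) * Q * (Q + 1)
      + (2 * Q * (a\<^sup>2 - k) + (Q + 1 / 2) * k) * ((Q + 1) * Q - k) - (Q + 1 / 2) * k * (Q - k)"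
    unfolding C using assms(3,4) by (simp add: field_simps power2_eq_square)
  also have "\<dots> = 0" unfolding a2 by (simp add: field_simps power2_eq_square)
  finally show ?thesis using assms(3,4) by simp
qed

text \<open>
  Why \<open>y'\<close> is a multiple of the Jacobi field at the boundary: write \<open>P = \<partial>\<^sub>a\<phi>\<close>,
  \<open>T = \<partial>\<^sub>a artanh contact\<close> and \<open>D = \<partial>\<^sub>s (\<phi> - artanh contact)\<close>, so that \<open>s\<^sub>0' D = T - P\<close>.  Then
  \<open>K\<^sup>2 y' D = (C - 2 a B\<^sup>2 / K\<^sup>2) D + 2 S (T - P)\<close>, and the part without \<open>P\<close> equals
  \<open>K C / (A\<^sup>2 B)\<close>; the total is \<open>2 B J\<close>.
\<close>
lemma cat_y_has_derivative:
  assumes a: "a > 1 / 2"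
  defines "s \<equiv> cat_s0 a"
  shows "(cat_y has_real_derivative
    2 * ((cat_B a s)\<^sup>2 - (cat_K a)\<^sup>2) / cat_K a ^ 3 * jacobi_profile a s) (at a)"
proof -
  define S C Q where "S = a * sinh (2 * s)" and "C = cosh (2 * s)" and "Q = (cat_B a s)\<^sup>2"
  define s' where "s' = cat_s0_deriv a"
  have s: "s > 0" and gt: "(cat_B a s)\<^sup>2 > (cat_K a)\<^sup>2"
    using cat_s0_pos[OF a] B_s0_gt_K[OF a] by (auto simp: s_def)
  have "S > 0" using a s by (simp add: S_def)
  note pos = this gt cat_pos[OF a, of s] cat_K_pos[OF a]
  have s0: "(cat_s0 has_real_derivative s') (at a)"
    using cat_s0_has_derivative[OF a] by (simp add: s'_def)
  have "((\<lambda>b. (b * cosh (2 * cat_s0 b) - 1 / 2) / (b\<^sup>2 - 1 / 4)) has_real_derivative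
      ((C + a * (S / a * (2 * s'))) * (a\<^sup>2 - 1 / 4) - (a * C - 1 / 2) * (2 * a))
        / ((a\<^sup>2 - 1 / 4) * (a\<^sup>2 - 1 / 4))) (at a)"
  proof -
    note [derivative_intros] = s0
    show ?thesis
      using a cat_K_arg_pos[OF a]
      by (auto intro!: derivative_eq_intros simp: C_def S_def s_def)
  qed
  also have "((C + a * (S / a * (2 * s'))) * (a\<^sup>2 - 1 / 4) - (a * C - 1 / 2) * (2 * a))
        / ((a\<^sup>2 - 1 / 4) * (a\<^sup>2 - 1 / 4))
      = (C + 2 * S * s' - 2 * a * Q / (cat_K a)\<^sup>2) / (cat_K a)\<^sup>2"
    unfolding cat_K_square[OF a, symmetric] Q_def cat_squares(2)[OF a] C_def[symmetric]
    using a pos by (simp add: field_simps)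
  finally have y: "(cat_y has_real_derivative
      (C + 2 * S * s' - 2 * a * Q / (cat_K a)\<^sup>2) / (cat_K a)\<^sup>2) (at a)"
    by (rule has_field_derivative_transform_within_open[of _ _ _ "{1 / 2<..}"])
       (use a in \<open>auto simp: cat_y_def cat_squares cat_K_square\<close>)
  have A: "(cat_A a s)\<^sup>2 = Q + 1" and aC: "a * C = Q + 1 / 2"
    using cat_squares[OF a, of s] by (auto simp: Q_def C_def)
  have S2: "S\<^sup>2 = (Q + 1) * Q - (cat_K a)\<^sup>2"
    using sinh_cat_square[OF a, of s] A by (simp add: S_def Q_def)
  have Q: "Q > 0" using pos by (simp add: Q_def)
  define P where "P = cat_phi_param a s"
  define T where "T = contact_param a s / (1 - (contact a s)\<^sup>2)"
  define D where "D = cat_B a s * cat_K a / (Q - (cat_K a)\<^sup>2)"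
  have D: "D > 0" using pos by (simp add: D_def Q_def)
  have "s' = - (P - T) / D"
    by (simp only: s'_def cat_s0_deriv_def Let_def s_def Q_def D_def P_def T_def)
  then have s'D: "s' * D = T - P"
    using D by simp
  have T: "2 * S * T = cat_K a / cat_B a s * (2 * Q * (a / (cat_K a)\<^sup>2 - 1 / a) + C)
      * S\<^sup>2 / ((Q + 1) * (Q - (cat_K a)\<^sup>2))"
  proof -
    define E where "E = a / (cat_K a)\<^sup>2 + C / (2 * Q) - 1 / a"
    have "2 * S * T = 2 * cat_B a s * cat_K a * E * S\<^sup>2 / ((Q + 1) * (Q - (cat_K a)\<^sup>2))"
      unfolding T_def contact_param_def one_minus_contact_square[OF a s]
      unfolding contact_def S_def[symmetric] C_def[symmetric] A Q_def[symmetric] E_def[symmetric]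
      using pos(1) by simp
    also have "2 * cat_B a s * cat_K a * E
        = cat_K a / cat_B a s * (2 * Q * (a / (cat_K a)\<^sup>2 - 1 / a) + C)"
      unfolding E_def Q_def using pos(3-) a
      by (simp add: divide_simps) (simp add: algebra_simps power2_eq_square)
    finally show ?thesis .
  qed
  have id: "(C - 2 * a * Q / (cat_K a)\<^sup>2) * D + 2 * S * T = cat_K a * C / ((Q + 1) * cat_B a s)"
  proof -
    have "((C - 2 * a * Q / (cat_K a)\<^sup>2) * D + 2 * S * T)
       = cat_K a * ((C - 2 * a * Q / (cat_K a)\<^sup>2) * Q * (Q + 1)
           + (2 * Q * (a / (cat_K a)\<^sup>2 - 1 / a) + C) * S\<^sup>2)
         / (cat_B a s * (Q + 1) * (Q - (cat_K a)\<^sup>2))"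
    proof -
      have D_eq: "D = cat_K a * Q / (cat_B a s * (Q - (cat_K a)\<^sup>2))"
        using pos by (simp add: D_def Q_def power2_eq_square)
      define X Y G
        where "X = C - 2 * a * Q / (cat_K a)\<^sup>2"
          and "Y = 2 * Q * (a / (cat_K a)\<^sup>2 - 1 / a) + C"
          and "G = Q - (cat_K a)\<^sup>2"
      have "G > 0" using gt by (simp add: G_def Q_def)
      then show ?thesis
        unfolding T D_eq X_def[symmetric] Y_def[symmetric] G_def[symmetric]
        using Q pos(3-) by (simp add: divide_simps) (simp add: algebra_simps)
    qed
    also have "\<dots> = cat_K a * (C * (Q - (cat_K a)\<^sup>2)) / (cat_B a s * (Q + 1) * (Q - (cat_K a)\<^sup>2))"
      unfolding S2 using boundary_identity[OF aC cat_K_square[OF a]] a pos by simp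
    finally show ?thesis
      using gt[folded Q_def] by (simp add: mult.commute)
  qed
  have "(C + 2 * S * s' - 2 * a * Q / (cat_K a)\<^sup>2) * D
      = (C - 2 * a * Q / (cat_K a)\<^sup>2) * D + 2 * S * (s' * D)"
    by (simp add: algebra_simps)
  also have "\<dots> = cat_K a * C / ((Q + 1) * cat_B a s) - 2 * S * P"
    unfolding s'D using id by (simp add: algebra_simps)
  also have "\<dots> = 2 * cat_B a s * jacobi_profile a s"
    unfolding jacobi_profile_def A S_def[symmetric] C_def[symmetric] P_def[symmetric]
    using pos Q by (simp add: divide_simps) (simp add: algebra_simps power2_eq_square)
  finally have "C + 2 * S * s' - 2 * a * Q / (cat_K a)\<^sup>2
      = 2 * cat_B a s * jacobi_profile a s / D"
    using D by (simp add: field_simps)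
  also have "\<dots> / (cat_K a)\<^sup>2
      = 2 * (Q - (cat_K a)\<^sup>2) / cat_K a ^ 3 * jacobi_profile a s"
    using pos by (simp add: D_def field_simps power2_eq_square power3_eq_cube)
  finally show ?thesis using y by (simp add: Q_def)
qed

section \<open>The Jacobi field along the profile\<close>

lemma has_vector_derivative_vec4:
  assumes "(f0 has_real_derivative d0) (at x)" "(f1 has_real_derivative d1) (at x)"
    "(f2 has_real_derivative d2) (at x)" "(f3 has_real_derivative d3) (at x)"
  shows "((\<lambda>x. vec4 (f0 x) (f1 x) (f2 x) (f3 x)) has_vector_derivative vec4 d0 d1 d2 d3) (at x)"
proof -
  have vec4_eq: "vec4 x0 x1 x2 x3 = x0 *\<^sub>R vec4 1 0 0 0 + x1 *\<^sub>R vec4 0 1 0 0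
      + x2 *\<^sub>R vec4 0 0 1 0 + x3 *\<^sub>R vec4 0 0 0 1" for x0 x1 x2 x3
    by (simp add: vec_eq_iff vec4_def)
  show ?thesis
    unfolding vec4_eq[of "f0 _"] vec4_eq[of d0]
    by (rule derivative_eq_intros assms refl)+ simp
qed

text \<open>
  In the plane of the first two coordinates both vectors are combinations of the Lorentz-orthonormal
  pair \<open>(cosh \<phi>, sinh \<phi>)\<close>, \<open>(sinh \<phi>, cosh \<phi>)\<close>, so neither \<open>\<phi>\<close> nor \<open>\<theta>\<close> survives in the product.
\<close>
lemma cat_jacobi_eq:
  assumes a: "a > 1 / 2" and s: "s \<ge> 0"
  shows "cat_jacobi a s \<theta> = jacobi_profile a s"
proof -
  define A B C P where "A = cat_A a s" and "B = cat_B a s" and "C = cosh (2 * s)"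
    and "P = cat_phi_param a s"
  define p q where "p = cosh (cat_phi a s)" and "q = sinh (cat_phi a s)"
  have pos: "A > 0" "B > 0" using cat_pos[OF a, of s] by (auto simp: A_def B_def)
  have AB: "A\<^sup>2 = B\<^sup>2 + 1" using cat_squares[OF a, of s] by (simp add: A_def B_def)
  have pq: "p\<^sup>2 = q\<^sup>2 + 1" by (simp add: p_def q_def cosh_square_eq)
  note [derivative_intros] = cat_param_derivs(1,2)[OF a, where s = s, folded A_def B_def C_def]
    cat_phi_has_param_derivative[OF a s, folded P_def]
  have "((\<lambda>b. cat_X b s \<theta>) has_vector_derivative
     vec4 (C / (2 * A) * p + A * q * P) (C / (2 * A) * q + A * p * P)
       (C / (2 * B) * cos \<theta>) (C / (2 * B) * sin \<theta>)) (at a)"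
    unfolding cat_X_def
    by (rule has_vector_derivative_vec4)
       (auto intro!: derivative_eq_intros simp: A_def B_def p_def q_def)
  then have "cat_jacobi a s \<theta> = lorentz (vec4 (C / (2 * A) * p + A * q * P)
      (C / (2 * A) * q + A * p * P) (C / (2 * B) * cos \<theta>) (C / (2 * B) * sin \<theta>)) (cat_nu a s \<theta>)"
    by (simp add: cat_jacobi_def vector_derivative_at)
  also have "\<dots> = - (C * cat_K a / (2 * A\<^sup>2)) * (p\<^sup>2 - q\<^sup>2)
      - a * sinh (2 * s) / B * P * (p\<^sup>2 - q\<^sup>2)
      + C * cat_K a / (2 * B\<^sup>2) * ((cos \<theta>)\<^sup>2 + (sin \<theta>)\<^sup>2)"
  proof -
    define c d where "c = cos \<theta>" and "d = sin \<theta>"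
    show ?thesis
      unfolding lorentz_def cat_nu_def vec4_nth A_def[symmetric] B_def[symmetric]
        p_def[symmetric] q_def[symmetric] c_def[symmetric] d_def[symmetric]
      using pos by (simp add: field_simps power2_eq_square)
  qed
  also have "\<dots> = C * cat_K a * (A\<^sup>2 - B\<^sup>2) / (2 * A\<^sup>2 * B\<^sup>2) - a * sinh (2 * s) / B * P"
    using pos by (simp add: pq field_simps)
  also have "\<dots> = jacobi_profile a s"
    unfolding jacobi_profile_def A_def[symmetric] B_def[symmetric] C_def[symmetric] P_def[symmetric]
    using AB by (simp add: mult.commute)
  finally show ?thesis .
qed

text \<open>
  The parametric Jacobi field divided by the translational Jacobi field \<open>S / B\<close>.
\<close>
definition jacobi_quotient :: "real \<Rightarrow> real \<Rightarrow> real" where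
  "jacobi_quotient a s = cat_K a * cosh (2 * s)
     / (2 * (cat_A a s)\<^sup>2 * cat_B a s * (a * sinh (2 * s))) - cat_phi_param a s"

lemma jacobi_profile_eq_quotient:
  assumes "a > 1 / 2" "s > 0"
  shows "jacobi_profile a s = a * sinh (2 * s) / cat_B a s * jacobi_quotient a s"
proof -
  have "sinh (2 * s) > 0" using assms by simp
  then show ?thesis
    using assms cat_pos[OF assms(1), of s]
    by (simp add: jacobi_profile_def jacobi_quotient_def field_simps power2_eq_square)
qed

text \<open>
  This is the Wronskian identity \<open>(J / (S/B))' = W / (S/B)\<^sup>2\<close> with \<open>B W = - a / K\<close>.  It is verified
  by differentiating: the contributions of \<open>\<partial>\<^sub>a\<phi>\<close> combine with the rest to an elementary
  expression whose numerator reduces to \<open>- a\<^sup>2 A\<^sup>2 B\<^sup>2\<close>.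
\<close>
lemma jacobi_quotient_has_derivative:
  assumes a: "a > 1 / 2" and s: "s > 0"
  shows "(jacobi_quotient a has_real_derivative
    - (a * cat_B a s / (cat_K a * (a * sinh (2 * s))\<^sup>2))) (at s)"
proof -
  define A B C K S where "A = cat_A a s" and "B = cat_B a s" and "C = cosh (2 * s)"
    and "K = cat_K a" and "S = a * sinh (2 * s)"
  have "S > 0" using a s by (simp add: S_def)
  note pos = this cat_pos[OF a, of s, folded A_def B_def] cat_K_pos[OF a, folded K_def]
  have aC: "a\<^sup>2 * C\<^sup>2 = A\<^sup>2 * B\<^sup>2 + 1 / 4"
    unfolding A_def B_def C_def cat_squares[OF a] by (simp add: algebra_simps power2_eq_square)
  have S2: "S\<^sup>2 = A\<^sup>2 * B\<^sup>2 - K\<^sup>2"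
    unfolding S_def A_def B_def K_def by (rule sinh_cat_square[OF a])
  have K2: "a\<^sup>2 = K\<^sup>2 + 1 / 4" using cat_K_square[OF a] by (simp add: K_def)
  define N' D D' where "N' = K * (2 * (S / a))" and "D = 2 * A\<^sup>2 * B * S"
    and "D' = 4 * S * B * S + 2 * A\<^sup>2 * (S / B) * S + 2 * A\<^sup>2 * B * (2 * (a * C))"
  have D: "D > 0" using pos by (simp add: D_def)
  note [derivative_intros] = cat_space_derivs[OF a, of s]
  have num: "((\<lambda>t. K * cosh (2 * t)) has_real_derivative N') (at s)"
    using a by (auto intro!: derivative_eq_intros simp: N'_def S_def)
  have den: "((\<lambda>t. 2 * (cat_A a t)\<^sup>2 * cat_B a t * (a * sinh (2 * t))) has_real_derivative D') (at s)"
    using pos by (auto intro!: derivative_eq_intros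
        simp: D'_def A_def[symmetric] B_def[symmetric] C_def[symmetric] S_def[symmetric])
      (simp add: S_def C_def algebra_simps)
  have "(jacobi_quotient a has_real_derivative
      (N' * D - K * C * D') / (D * D) - slope_param a s) (at s)"
  proof -
    have "2 * (cat_A a s)\<^sup>2 * cat_B a s * (a * sinh (2 * s)) \<noteq> 0"
      using pos a s by (simp add: A_def B_def)
    from DERIV_diff[OF DERIV_divide[OF num den this] cat_phi_param_has_space_derivative[OF a s]]
    show ?thesis
      unfolding jacobi_quotient_def by (simp only: A_def B_def C_def S_def D_def K_def)
  qed
  also have "(N' * D - K * C * D') / (D * D) - slope_param a s
    = (K\<^sup>2 * S\<^sup>2 - K\<^sup>2 * (a\<^sup>2 * C\<^sup>2) - a\<^sup>2 * S\<^sup>2) / (a * K * A\<^sup>2 * B * S\<^sup>2)"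
    unfolding N'_def D_def D'_def slope_param_def slope_def
      A_def[symmetric] B_def[symmetric] C_def[symmetric] K_def[symmetric]
    using pos a
    by (simp add: divide_simps)
      (simp add: algebra_simps power2_eq_square power3_eq_cube power4_eq_xxxx)
  also have "K\<^sup>2 * S\<^sup>2 - K\<^sup>2 * (a\<^sup>2 * C\<^sup>2) - a\<^sup>2 * S\<^sup>2 = - (a\<^sup>2 * A\<^sup>2 * B\<^sup>2)"
    unfolding aC S2 unfolding K2 by (simp add: algebra_simps power2_eq_square)
  also have "\<dots> / (a * K * A\<^sup>2 * B * S\<^sup>2) = - (a * B / (K * S\<^sup>2))"
    using pos a by (simp add: field_simps power2_eq_square)
  finally show ?thesis by (simp add: B_def K_def S_def)
qed

text \<open>
  For \<open>s > 0\<close> the quotient at \<open>s\<close> is at least the quotient at \<open>l\<close>.  At \<open>s = 0\<close>, where the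
  translational field vanishes, the quotient says nothing, but there \<open>J = K / (2 A\<^sup>2 B\<^sup>2) > 0\<close>.
\<close>
lemma jacobi_profile_pos:
  assumes a: "a > 1 / 2" and pos: "jacobi_profile a l > 0" and s: "0 \<le> s" "s \<le> l"
  shows "jacobi_profile a s > 0"
proof (cases "s = 0")
  case True
  then show ?thesis
    using cat_pos[OF a, of 0] cat_K_pos[OF a] by (simp add: jacobi_profile_def)
next
  case False
  then have s0: "s > 0" and l0: "l > 0" using s by auto
  have factor: "a * sinh (2 * t) / cat_B a t > 0" if "t > 0" for t
    using that a cat_pos[OF a, of t] by simp
  have "jacobi_quotient a l > 0"
    using pos factor[OF l0] unfolding jacobi_profile_eq_quotient[OF a l0]
    by (simp only: zero_less_mult_pos)
  also have "jacobi_quotient a l \<le> jacobi_quotient a s"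
  proof (rule DERIV_nonpos_imp_nonincreasing[OF s(2)])
    fix t assume "s \<le> t" "t \<le> l"
    then have t: "t > 0" using s0 by simp
    show "\<exists>D. (jacobi_quotient a has_real_derivative D) (at t) \<and> D \<le> 0"
      using jacobi_quotient_has_derivative[OF a t] cat_pos[OF a, of t] cat_K_pos[OF a] a
      by (intro exI conjI) auto
  qed
  finally show ?thesis
    using factor[OF s0] by (simp only: jacobi_profile_eq_quotient[OF a s0] mult_pos_pos)
qed

section \<open>The equivalent conditions\<close>

lemma has_derivative_over_sqrt:
  fixes y :: "real \<Rightarrow> real"
  assumes "(y has_real_derivative y') (at a)" "y a > 1"
  shows "((\<lambda>b. y b / sqrt (y b - 1)) has_real_derivative
    y' * (y a - 2) / (2 * sqrt (y a - 1) ^ 3)) (at a)"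
proof -
  define q where "q = sqrt (y a - 1)"
  have q: "q > 0" "y a = q\<^sup>2 + 1" using assms(2) by (auto simp: q_def)
  note [derivative_intros] = assms(1)
  have root: "((\<lambda>b. sqrt (y b - 1)) has_real_derivative y' / (2 * q)) (at a)"
    using q(1) assms(2) by (auto intro!: derivative_eq_intros simp: q_def[symmetric] field_simps)
  have "(y' * q - y a * (y' / (2 * q))) / (q * q) = y' * (y a - 2) / (2 * q ^ 3)"
    unfolding q(2) using q(1) by (simp add: field_simps power2_eq_square power3_eq_cube)
  then show ?thesis
    using DERIV_divide[OF assms(1) root] q(1) by (simp add: q_def[symmetric])
qed

text \<open>
  By \<open>sinh_cat_r\<close>, \<open>r\<close> is \<open>arsinh\<close> of a differentiable expression in \<open>K\<close> and \<open>y\<close>.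
\<close>
lemma cat_r_differentiable:
  assumes a: "a > 1 / 2"
  shows "(cat_r has_real_derivative deriv cat_r a) (at a)"
proof -
  have y: "(cat_y has_real_derivative deriv cat_y a) (at a)"
    using DERIV_deriv_iff_real_differentiable cat_y_has_derivative[OF a] real_differentiable_def
    by blast
  obtain D where
    "((\<lambda>b. arsinh (cat_K b * (cat_y b / sqrt (cat_y b - 1)))) has_real_derivative D) (at a)"
    using DERIV_chain2[where f = arsinh
          and g = "\<lambda>b. cat_K b * (cat_y b / sqrt (cat_y b - 1))", OF arsinh_real_has_field_derivative
        DERIV_mult[OF cat_param_derivs(3)[OF a] has_derivative_over_sqrt[OF y cat_y_gt_one[OF a]]]]
    by blast
  then have "(cat_r has_real_derivative D) (at a)"
  proof (rule has_field_derivative_transform_within_open[of _ _ _ "{1 / 2<..}"])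
    fix b :: real assume b: "b \<in> {1 / 2<..}"
    then have "cat_K b > 0" by (simp add: cat_K_pos)
    then show "arsinh (cat_K b * (cat_y b / sqrt (cat_y b - 1))) = cat_r b"
      using b by (simp add: sinh_cat_r[symmetric] arsinh_sinh_real)
  qed (use a in auto)
  then show ?thesis by (simp add: DERIV_imp_deriv)
qed

theorem theorem11p5:
  fixes a :: real
  assumes "a > 1 / 2"
    and "(cat_B a (cat_s0 a))\<^sup>2 > 2 * (cat_K a)\<^sup>2"
  shows "((\<forall>s\<in>{0..cat_s0 a}. \<forall>\<theta>. cat_jacobi a s \<theta> > 0) \<longleftrightarrow> (\<forall>\<theta>. cat_jacobi a (cat_s0 a) \<theta> > 0))
    \<and> ((\<forall>\<theta>. cat_jacobi a (cat_s0 a) \<theta> > 0) \<longleftrightarrow> (cat_K a)\<^sup>2 * deriv cat_r a * coth (cat_r a) > a)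
    \<and> ((cat_K a)\<^sup>2 * deriv cat_r a * coth (cat_r a) > a
         \<longleftrightarrow> (a\<^sup>2 - 1 / 4) * deriv cat_r a > a * tanh (cat_r a))
    \<and> ((a\<^sup>2 - 1 / 4) * deriv cat_r a > a * tanh (cat_r a)
         \<longleftrightarrow> deriv (\<lambda>b. sinh (cat_r b) / cat_K b) a > 0)
    \<and> (deriv (\<lambda>b. sinh (cat_r b) / cat_K b) a > 0 \<longleftrightarrow> deriv cat_y a > 0)"
proof -
  note a = assms(1)
  define K r r' where "K = cat_K a" and "r = cat_r a" and "r' = deriv cat_r a"
  have K: "K > 0" "K\<^sup>2 = a\<^sup>2 - 1 / 4" and r: "sinh r > 0" "cosh r > 0"
    using cat_K_pos[OF a] cat_K_square[OF a] cat_r_pos[OF a] by (auto simp: K_def r_def)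
  have s0: "cat_s0 a > 0" by (rule cat_s0_pos[OF a])
  have jac: "(\<forall>\<theta>. cat_jacobi a s \<theta> > 0) \<longleftrightarrow> jacobi_profile a s > 0" if "s \<ge> 0" for s
    using cat_jacobi_eq[OF a that] by simp
  have i_ii: "(\<forall>s\<in>{0..cat_s0 a}. \<forall>\<theta>. cat_jacobi a s \<theta> > 0)
      \<longleftrightarrow> (\<forall>\<theta>. cat_jacobi a (cat_s0 a) \<theta> > 0)"
    using jac s0 jacobi_profile_pos[OF a] by force
  have ii_v: "(\<forall>\<theta>. cat_jacobi a (cat_s0 a) \<theta> > 0) \<longleftrightarrow> deriv cat_y a > 0"
  proof -
    have "2 * ((cat_B a (cat_s0 a))\<^sup>2 - (cat_K a)\<^sup>2) / cat_K a ^ 3 > 0"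
      using B_s0_gt_K[OF a] K by (simp add: K_def)
    then show ?thesis
      unfolding jac[OF less_imp_le[OF s0]] DERIV_imp_deriv[OF cat_y_has_derivative[OF a]]
      by (simp only: zero_less_mult_iff) auto
  qed
  have iv_v: "deriv (\<lambda>b. sinh (cat_r b) / cat_K b) a > 0 \<longleftrightarrow> deriv cat_y a > 0"
  proof -
    have y: "(cat_y has_real_derivative deriv cat_y a) (at a)"
      using DERIV_deriv_iff_real_differentiable cat_y_has_derivative[OF a] real_differentiable_def
      by blast
    have y2: "cat_y a > 2"
      using assms(2) K by (simp add: cat_y_def K_def field_simps)
    have "((\<lambda>b. sinh (cat_r b) / cat_K b) has_real_derivative
        deriv cat_y a * (cat_y a - 2) / (2 * sqrt (cat_y a - 1) ^ 3)) (at a)"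
      using has_derivative_over_sqrt[OF y cat_y_gt_one[OF a]]
      by (rule has_field_derivative_transform_within_open[of _ _ _ "{1 / 2<..}"])
         (use a in \<open>auto simp: sinh_cat_r\<close>)
    then show ?thesis
      using y2 by (simp add: DERIV_imp_deriv zero_less_divide_iff zero_less_mult_iff)
  qed
  have iii: "(cat_K a)\<^sup>2 * deriv cat_r a * coth (cat_r a) > a
      \<longleftrightarrow> (a\<^sup>2 - 1 / 4) * deriv cat_r a > a * tanh (cat_r a)"
    using r by (simp add: coth_def tanh_def K(2)[unfolded K_def] r_def[symmetric] field_simps)
  have iii_iv: "(a\<^sup>2 - 1 / 4) * deriv cat_r a > a * tanh (cat_r a)
      \<longleftrightarrow> deriv (\<lambda>b. sinh (cat_r b) / cat_K b) a > 0"
  proof -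
    have "((\<lambda>b. sinh (cat_r b) / cat_K b) has_real_derivative
        (cosh r * r' * K - sinh r * (a / K)) / (K * K)) (at a)"
    proof -
      note [derivative_intros] = cat_r_differentiable[OF a] cat_param_derivs(3)[OF a]
      show ?thesis
        using K by (auto intro!: derivative_eq_intros simp: r_def r'_def K_def)
    qed
    also have "(cosh r * r' * K - sinh r * (a / K)) / (K * K)
        = (K\<^sup>2 * r' - a * tanh r) * (cosh r / K ^ 3)"
      using K(1) r(2) by (simp add: tanh_def field_simps power2_eq_square power3_eq_cube)
    finally have "deriv (\<lambda>b. sinh (cat_r b) / cat_K b) a = (K\<^sup>2 * r' - a * tanh r) * (cosh r / K ^ 3)"
      by (rule DERIV_imp_deriv)
    moreover have "cosh r / K ^ 3 > 0" using K(1) r(2) by simp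
    ultimately have "deriv (\<lambda>b. sinh (cat_r b) / cat_K b) a > 0 \<longleftrightarrow> K\<^sup>2 * r' - a * tanh r > 0"
      by (simp only: zero_less_mult_iff) auto
    then show ?thesis
      by (simp add: K(2)[symmetric] r_def r'_def)
  qed
  show ?thesis using i_ii ii_v iv_v iii iii_iv by blast
qed

end
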